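(* Let $Y_0,Y_1$ be $\{0,1\}$-valued random variables (the potential outcomes) and let $X$ be a random variable (the features), all defined on a common probability space. Put $S_0(x)=P(Y_0=1\mid X=x)$, $S_1(x)=P(Y_1=1\mid X=x)$, $S_0=P(Y_0=1)=\mathbb{E}[S_0(X)]$, $S_1=P(Y_1=1)=\mathbb{E}[S_1(X)]$, and $$\alpha=P(Y_0=0,Y_1=0),\quad \beta=P(Y_0=1,Y_1=0),\quad \gamma=P(Y_0=0,Y_1=1),\quad \delta=P(Y_0=1,Y_1=1).$$ Then the following (uplift) bounds hold: $$\mathbb{E}[\max\{0,1-S_0(X)-S_1(X)\}]\le\alpha\le\mathbb{E}[\min\{1-S_0(X),1-S_1(X)\}],$$ $$\mathbb{E}[\max\{0,S_0(X)-S_1(X)\}]\le\beta\le\mathbb{E}[\min\{S_0(X),1-S_1(X)\}],$$ $$\mathbb{E}[\max\{0,S_1(X)-S_0(X)\}]\le\gamma\le\mathbb{E}[\min\{1-S_0(X),S_1(X)\}],$$ $$\mathbb{E}[\max\{0,S_0(X)+S_1(X)-1\}]\le\delta\le\mathbb{E}[\min\{S_0(X),S_1(X)\}].$$ Moreover, each of these bounds is at least as tight as the corresponding Fréchet bound, i.e. the bound obtained by replacing $S_0(X),S_1(X)$ by the constants $S_0,S_1$: each lower bound above is greater than or equal to, respectively, $\max\{0,1-S_0-S_1\}$, $\max\{0,S_0-S_1\}$, $\max\{0,S_1-S_0\}$, $\max\{0,S_0+S_1-1\}$, and each upper bound above is less than or equal to, respectively, $\min\{1-S_0,1-S_1\}$,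 $\min\{S_0,1-S_1\}$, $\min\{1-S_0,S_1\}$, $\min\{S_0,S_1\}$.
   Context: $Y_t$ denotes the binary outcome under the intervention setting a binary treatment to $t\in\{0,1\}$. Expectations $\mathbb{E}$ of functions of $X$ are over the distribution of $X$. *)

theory Defs
  imports "HOL-Probability.Probability"
begin

text \<open>
  \<open>is_cond_prob M N X A s\<close> says that \<open>s\<close> is a version of \<open>x \<mapsto> P(A | X = x)\<close>: a measurable
  function on the value space \<open>N\<close> of \<open>X\<close> whose composition with \<open>X\<close> is almost surely the
  conditional expectation of the indicator of \<open>A\<close> given the sigma-algebra generated by \<open>X\<close>.
  Conditioning on \<open>X = x\<close> elementwise would not do, since these events may be null.  Versions are
  only determined up to null sets of the distribution of \<open>X\<close>; one always exists, see
  \<open>is_cond_prob_exists\<close>.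
\<close>
definition is_cond_prob ::
  "'a measure \<Rightarrow> 'b measure \<Rightarrow> ('a \<Rightarrow> 'b) \<Rightarrow> 'a set \<Rightarrow> ('b \<Rightarrow> real) \<Rightarrow> bool" where
  "is_cond_prob M N X A s \<longleftrightarrow>
     s \<in> borel_measurable N \<and>
     (AE \<omega> in M. s (X \<omega>) =
        real_cond_exp M (vimage_algebra (space M) X N) (indicator A) \<omega>)"

lemma is_cond_prob_exists:
  assumes "prob_space M" and X [measurable]: "X \<in> M \<rightarrow>\<^sub>M N" and A [measurable]: "A \<in> sets M"
  shows "\<exists>s. is_cond_prob M N X A s"
proof -
  interpret prob_space M by fact
  define F where "F = vimage_algebra (space M) X N"
  have XN: "X \<in> space M \<rightarrow> space N" using X by (auto simp: measurable_def)
  have XF [measurable]: "X \<in> F \<rightarrow>\<^sub>M N"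
    unfolding F_def by (rule measurable_vimage_algebra1) (rule XN)
  have sub: "subalgebra M F"
    unfolding subalgebra_def F_def by (auto simp: sets_vimage_algebra2[OF XN])
  interpret F: finite_measure_subalgebra M F
    by unfold_locales (rule sub)
  define P where "P = distr M N X"
  define \<nu> where "\<nu> = distr (density M (indicator A)) N X"
  interpret P: prob_space P unfolding P_def by (rule prob_space_distr) simp
  have [simp]: "sets P = sets N" "space P = space N" by (auto simp: P_def)
  have nu: "emeasure \<nu> C = emeasure M (A \<inter> (X -` C \<inter> space M))" if "C \<in> sets N" for C
    using that X by (simp add: \<nu>_def emeasure_distr emeasure_density flip: indicator_inter_arith)
  have fin_nu: "finite_measure \<nu>"
    by (rule finite_measureI) (simp add: nu[OF sets.top] \<nu>_def[THEN arg_cong, of space])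
  have ac: "absolutely_continuous P \<nu>"
    unfolding absolutely_continuous_def
  proof
    fix C assume "C \<in> null_sets P"
    then have C: "C \<in> sets N" "emeasure M (X -` C \<inter> space M) = 0"
      by (auto simp: null_sets_def P_def emeasure_distr)
    have "emeasure \<nu> C \<le> emeasure M (X -` C \<inter> space M)"
      unfolding nu[OF C(1)] using C(1) by (intro emeasure_mono) auto
    with C show "C \<in> null_sets \<nu>" by (auto simp: null_sets_def \<nu>_def)
  qed
  define f where "f = RN_deriv P \<nu>"
  have f [measurable]: "f \<in> borel_measurable N"
    using borel_measurable_RN_deriv[of P \<nu>] by (simp add: f_def cong: measurable_cong_sets)
  have sn: "sets \<nu> = sets P" by (simp add: \<nu>_def)
  have dens: "density P f = \<nu>"
    unfolding f_def by (rule P.density_RN_deriv[OF ac sn])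
  have ffin: "AE x in P. f x \<noteq> \<infinity>"
    unfolding f_def
    by (rule P.RN_deriv_finite[OF _ ac sn])
      (rule finite_measure.axioms(1)[OF fin_nu])
  define s where "s = (\<lambda>x. enn2real (f x))"
  have s [measurable]: "s \<in> borel_measurable N" unfolding s_def by measurable
  have nn: "(\<integral>\<^sup>+\<omega>. ennreal (s (X \<omega>) * indicator (X -` C \<inter> space M) \<omega>) \<partial>M)
      = emeasure M (A \<inter> (X -` C \<inter> space M))" if C [measurable]: "C \<in> sets N" for C
  proof -
    have "(\<integral>\<^sup>+\<omega>. ennreal (s (X \<omega>) * indicator (X -` C \<inter> space M) \<omega>) \<partial>M)
        = (\<integral>\<^sup>+\<omega>. ennreal (s (X \<omega>)) * indicator C (X \<omega>) \<partial>M)"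
      by (intro nn_integral_cong) (auto simp: indicator_def)
    also have "\<dots> = (\<integral>\<^sup>+x. ennreal (s x) * indicator C x \<partial>P)"
      unfolding P_def by (simp add: nn_integral_distr)
    also have "\<dots> = (\<integral>\<^sup>+x. f x * indicator C x \<partial>P)"
      by (intro nn_integral_cong_AE, use ffin in eventually_elim) (auto simp: s_def less_top)
    also have "\<dots> = emeasure \<nu> C"
      by (subst dens[symmetric], subst emeasure_density) (auto simp: P_def)
    finally show ?thesis by (simp add: nu)
  qed
  have sX: "integrable M (\<lambda>\<omega>. s (X \<omega>))"
  proof (rule integrableI_nonneg)
    have "(\<integral>\<^sup>+\<omega>. ennreal (s (X \<omega>)) \<partial>M)
        = (\<integral>\<^sup>+\<omega>. ennreal (s (X \<omega>) * indicator (X -` space N \<inter> space M) \<omega>) \<partial>M)"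
      using XN by (intro nn_integral_cong) (auto simp: indicator_def)
    also have "\<dots> < \<infinity>" by (subst nn) (auto simp: less_top[symmetric])
    finally show "(\<integral>\<^sup>+\<omega>. ennreal (s (X \<omega>)) \<partial>M) < \<infinity>" .
  qed (auto simp: s_def)
  have "AE \<omega> in M. real_cond_exp M F (indicator A) \<omega> = s (X \<omega>)"
  proof (rule F.real_cond_exp_charact)
    fix B assume "B \<in> sets F"
    then obtain C where C [measurable]: "C \<in> sets N" and B: "B = X -` C \<inter> space M"
      by (auto simp: F_def sets_vimage_algebra2[OF XN])
    have "(\<integral>\<omega>\<in>B. indicator A \<omega> \<partial>M) = measure M (A \<inter> B)"
      unfolding set_lebesgue_integral_def B
      by (simp add: Int_commute flip: indicator_inter_arith)
    also have "\<dots> = enn2real (\<integral>\<^sup>+\<omega>. ennreal (s (X \<omega>) * indicator B \<omega>) \<partial>M)"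
      unfolding B nn[OF C] measure_def ..
    also have "\<dots> = (\<integral>\<omega>. s (X \<omega>) * indicator B \<omega> \<partial>M)"
      unfolding B by (rule integral_eq_nn_integral[symmetric]) (auto simp: s_def)
    also have "\<dots> = (\<integral>\<omega>\<in>B. s (X \<omega>) \<partial>M)"
      by (simp add: set_lebesgue_integral_def mult.commute)
    finally show "(\<integral>\<omega>\<in>B. indicator A \<omega> \<partial>M) = (\<integral>\<omega>\<in>B. s (X \<omega>) \<partial>M)" .
  qed (use sX in \<open>auto intro!: integrable_real_indicator simp: less_top[symmetric]\<close>)
  then have "is_cond_prob M N X A s"
    unfolding is_cond_prob_def F_def[symmetric] by auto
  then show ?thesis by blast
qed

end

(* The set C where S_A(X) + S_B(X) > 1 is determined by X, so on it the S's integrate like the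
   indicators of A and B.  Hence E[max 0 (S_A(X) + S_B(X) - 1)] is the integral of 1_A + 1_B - 1
   over {X in C}, and 1_A + 1_B - 1 <= 1_(A Int B).  The upper bound on P(A Int B) is the lower bound
   on P(A - B), because min a b = a - max 0 (a + (1 - b) - 1).  Each of the four cells is such an
   intersection, of events Y_t = 1 or their complements. *)
theory Submission
  imports Defs
begin

context prob_space
begin

text \<open>Makes the theory of \<open>real_cond_exp\<close> available for the sigma-algebra
  generated by \<open>X\<close>, whose sets are the preimages under \<open>X\<close> of sets in
  \<open>N\<close>.\<close>

lemma finite_measure_subalgebra_vimage_algebra:
  assumes X: "X \<in> M \<rightarrow>\<^sub>M N"
  shows "finite_measure_subalgebra M (vimage_algebra (space M) X N)"
proof unfold_locales
  have "X \<in> space M \<rightarrow> space N" using X by (auto simp: measurable_def)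
  then show "subalgebra M (vimage_algebra (space M) X N)"
    using X by (auto simp: subalgebra_def sets_vimage_algebra2)
qed

text \<open>A version \<open>s\<close> is pinned down only almost surely along \<open>X\<close> and
  may leave [0,1] on a null set, so integrability is inherited from the conditional expectation
  through almost sure equality instead of from a pointwise bound.\<close>

lemma is_cond_prob_integrable:
  assumes X [measurable]: "X \<in> M \<rightarrow>\<^sub>M N" and A [measurable]: "A \<in> events"
    and s: "is_cond_prob M N X A s"
  shows "integrable M (\<lambda>\<omega>. s (X \<omega>))"
proof -
  define F where "F = vimage_algebra (space M) X N"
  interpret F: finite_measure_subalgebra M F
    unfolding F_def by (rule finite_measure_subalgebra_vimage_algebra[OF X])
  have [measurable]: "s \<in> borel_measurable N" using s by (simp add: is_cond_prob_def)
  have "integrable M (real_cond_exp M F (indicator A))"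
    by (intro F.real_cond_exp_int) (simp add: integrable_real_indicator less_top[symmetric])
  then show ?thesis
    by (rule integrable_cong_AE_imp) (use s in \<open>auto simp: is_cond_prob_def F_def\<close>)
qed

text \<open>The averaging property of conditional expectation: the event that \<open>X\<close> lies
  in \<open>C\<close> belongs to the sigma-algebra generated by \<open>X\<close>, and on such events
  \<open>s (X \<omega>)\<close> may be traded for the indicator of \<open>A\<close>.\<close>

lemma is_cond_prob_integral_indicator:
  assumes X [measurable]: "X \<in> M \<rightarrow>\<^sub>M N" and A [measurable]: "A \<in> events"
    and s: "is_cond_prob M N X A s" and C [measurable]: "C \<in> sets N"
  shows "(\<integral>\<omega>. indicator C (X \<omega>) * s (X \<omega>) \<partial>M)
    = (\<integral>\<omega>. indicator C (X \<omega>) * indicator A \<omega> \<partial>M)"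
proof -
  define F where "F = vimage_algebra (space M) X N"
  interpret F: finite_measure_subalgebra M F
    unfolding F_def by (rule finite_measure_subalgebra_vimage_algebra[OF X])
  have [measurable]: "s \<in> borel_measurable N" using s by (simp add: is_cond_prob_def)
  have "X \<in> space M \<rightarrow> space N" using X by (auto simp: measurable_def)
  \<comment> \<open>This makes \<open>indicator C (X \<omega>)\<close> measurable with respect to
    \<open>F\<close>, as a factor pulled through the conditional expectation must be.\<close>
  then have [measurable]: "X \<in> F \<rightarrow>\<^sub>M N"
    unfolding F_def by (rule measurable_vimage_algebra1)
  have "(\<integral>\<omega>. indicator C (X \<omega>) * s (X \<omega>) \<partial>M)
      = (\<integral>\<omega>. indicator C (X \<omega>) * real_cond_exp M F (indicator A) \<omega> \<partial>M)"
    by (rule integral_cong_AE) (use s in \<open>auto simp: is_cond_prob_def F_def\<close>)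
  also have "\<dots> = (\<integral>\<omega>. indicator C (X \<omega>) * indicator A \<omega> \<partial>M)"
    by (rule F.real_cond_exp_intg(2))
      (auto intro!: integrable_const_bound[where B=1] simp: indicator_def)
  finally show ?thesis .
qed

text \<open>The law of total probability: the averaging property with \<open>C\<close> the whole
  value space, whose indicator is 1 along \<open>X\<close>.\<close>

lemma is_cond_prob_expectation:
  assumes X [measurable]: "X \<in> M \<rightarrow>\<^sub>M N" and A: "A \<in> events"
    and s: "is_cond_prob M N X A s"
  shows "expectation (\<lambda>\<omega>. s (X \<omega>)) = prob A"
proof -
  have *: "indicator (space N) (X \<omega>) = (1::real)" if "\<omega> \<in> space M" for \<omega>
    using measurable_space[OF X that] by simp
  have "expectation (\<lambda>\<omega>. s (X \<omega>)) = (\<integral>\<omega>. indicator (space N) (X \<omega>) * s (X \<omega>) \<partial>M)"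
    by (intro Bochner_Integration.integral_cong) (auto simp: *)
  also have "\<dots> = (\<integral>\<omega>. indicator (space N) (X \<omega>) * indicator A \<omega> \<partial>M)"
    by (rule is_cond_prob_integral_indicator[OF assms sets.top])
  also have "\<dots> = (\<integral>\<omega>. indicator A \<omega> \<partial>M)"
    by (intro Bochner_Integration.integral_cong) (auto simp: *)
  also have "\<dots> = prob A"
    using A by simp
  finally show ?thesis .
qed

text \<open>Holds by linearity of conditional expectation, the constant 1 being its own conditional
  expectation. It turns versions for Y_t = 1 into versions for Y_t = 0.\<close>

lemma is_cond_prob_compl:
  assumes X [measurable]: "X \<in> M \<rightarrow>\<^sub>M N" and A [measurable]: "A \<in> events"
    and s: "is_cond_prob M N X A s"
  shows "is_cond_prob M N X (space M - A) (\<lambda>x. 1 - s x)"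
proof -
  define F where "F = vimage_algebra (space M) X N"
  interpret F: finite_measure_subalgebra M F
    unfolding F_def by (rule finite_measure_subalgebra_vimage_algebra[OF X])
  have [measurable]: "s \<in> borel_measurable N" using s by (simp add: is_cond_prob_def)
  have one: "AE \<omega> in M. real_cond_exp M F (\<lambda>_. 1) \<omega> = 1"
    by (rule F.real_cond_exp_F_meas) auto
  have diff: "AE \<omega> in M. real_cond_exp M F (\<lambda>\<omega>. 1 - indicator A \<omega>) \<omega>
      = real_cond_exp M F (\<lambda>_. 1) \<omega> - real_cond_exp M F (indicator A) \<omega>"
    by (rule F.real_cond_exp_diff) (auto simp: integrable_real_indicator less_top[symmetric])
  have compl: "AE \<omega> in M. real_cond_exp M F (indicator (space M - A)) \<omega>
      = real_cond_exp M F (\<lambda>\<omega>. 1 - indicator A \<omega>) \<omega>"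
    by (rule F.real_cond_exp_cong) (auto simp: indicator_def)
  have "AE \<omega> in M. s (X \<omega>) = real_cond_exp M F (indicator A) \<omega>"
    using s by (simp add: is_cond_prob_def F_def)
  with one diff compl
  have "AE \<omega> in M. 1 - s (X \<omega>) = real_cond_exp M F (indicator (space M - A)) \<omega>"
    by eventually_elim simp
  then show ?thesis
    by (simp add: is_cond_prob_def F_def)
qed

lemma cond_frechet_lower:
  assumes X [measurable]: "X \<in> M \<rightarrow>\<^sub>M N"
    and A [measurable]: "A \<in> events" and B [measurable]: "B \<in> events"
    and a: "is_cond_prob M N X A a" and b: "is_cond_prob M N X B b"
  shows "expectation (\<lambda>\<omega>. max 0 (a (X \<omega>) + b (X \<omega>) - 1)) \<le> prob (A \<inter> B)"
proof -
  have [measurable]: "a \<in> borel_measurable N" "b \<in> borel_measurable N"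
    using a b by (simp_all add: is_cond_prob_def)
  \<comment> \<open>\<open>C\<close> is where the maximum is positive, so that the maximum equals
    \<open>indicator C x * (a x + b x - 1)\<close>, an expression linear in \<open>a\<close> and
    \<open>b\<close>.\<close>
  define C where "C = {x \<in> space N. a x + b x > 1}"
  have C [measurable]: "C \<in> sets N" unfolding C_def by measurable
  let ?C = "\<lambda>\<omega>. indicator C (X \<omega>) :: real"
  have intC: "integrable M (\<lambda>\<omega>. ?C \<omega> * f \<omega>)" if [measurable]: "integrable M f"
    for f :: "'a \<Rightarrow> real"
    by (rule Bochner_Integration.integrable_bound[OF that]) (auto simp: indicator_def)
  have int1: "integrable M ?C"
    by (rule integrable_const_bound[where B=1]) (auto simp: indicator_def)
  have intA: "integrable M (indicator A :: 'a \<Rightarrow> real)" "integrable M (indicator B :: 'a \<Rightarrow> real)"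
    by (simp_all add: integrable_real_indicator less_top[symmetric])
  note ia = intC[OF is_cond_prob_integrable[OF X A a]] intC[OF is_cond_prob_integrable[OF X B b]]
  have "expectation (\<lambda>\<omega>. max 0 (a (X \<omega>) + b (X \<omega>) - 1))
      = expectation (\<lambda>\<omega>. ?C \<omega> * a (X \<omega>) + ?C \<omega> * b (X \<omega>) - ?C \<omega>)"
    using measurable_space[OF X]
    by (intro Bochner_Integration.integral_cong) (auto simp: C_def indicator_def)
  also have "\<dots> = expectation (\<lambda>\<omega>. ?C \<omega> * indicator A \<omega> + ?C \<omega> * indicator B \<omega> - ?C \<omega>)"
    using ia int1 intA[THEN intC] is_cond_prob_integral_indicator[OF X A a C]
      is_cond_prob_integral_indicator[OF X B b C]
    by simp
  \<comment> \<open>Pointwise comparison: off \<open>C\<close> the left side is 0; on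
    \<open>C\<close> it is 1 if both events occur and at most 0 otherwise.\<close>
  also have "\<dots> \<le> expectation (indicator (A \<inter> B))"
    by (intro integral_mono Bochner_Integration.integrable_diff
        Bochner_Integration.integrable_add intA[THEN intC] int1)
      (auto simp: integrable_real_indicator less_top[symmetric] indicator_def)
  also have "\<dots> = prob (A \<inter> B)" by simp
  finally show ?thesis .
qed

lemma cond_frechet_upper:
  assumes X [measurable]: "X \<in> M \<rightarrow>\<^sub>M N"
    and A [measurable]: "A \<in> events" and B [measurable]: "B \<in> events"
    and a: "is_cond_prob M N X A a" and b: "is_cond_prob M N X B b"
  shows "prob (A \<inter> B) \<le> expectation (\<lambda>\<omega>. min (a (X \<omega>)) (b (X \<omega>)))"
proof -
  note ia = is_cond_prob_integrable[OF X A a] and ib = is_cond_prob_integrable[OF X B b]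
  \<comment> \<open>The term \<open>1 - b\<close> is kept unsimplified because it is the version for
    the complement of \<open>B\<close>, to which the lower bound is applied next.\<close>
  have "expectation (\<lambda>\<omega>. min (a (X \<omega>)) (b (X \<omega>)))
      = expectation (\<lambda>\<omega>. a (X \<omega>) - max 0 (a (X \<omega>) + (1 - b (X \<omega>)) - 1))"
    by (intro Bochner_Integration.integral_cong) auto
  also have "\<dots> = prob A - expectation (\<lambda>\<omega>. max 0 (a (X \<omega>) + (1 - b (X \<omega>)) - 1))"
    using ia ib
    by (subst Bochner_Integration.integral_diff)
      (auto intro!: integrable_max simp: is_cond_prob_expectation[OF X A a])
  \<comment> \<open>The lower bound on \<open>prob (A - B)\<close> is subtracted from the exact
    value \<open>prob A\<close>, which reverses the inequality.\<close>
  also have "\<dots> \<ge> prob A - prob (A \<inter> (space M - B))"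
    using cond_frechet_lower[OF X A _ a is_cond_prob_compl[OF X B b]] by simp
  also have "prob A - prob (A \<inter> (space M - B)) = prob (A \<inter> B)"
  proof -
    have "A \<inter> (space M - B) = A - B" using sets.sets_into_space[OF A] by auto
    then show ?thesis using finite_measure_Diff'[OF A B] by simp
  qed
  finally show ?thesis .
qed

text \<open>Jensen's inequality for a convex function that is a maximum of two affine ones: each
  affine piece lies below the maximum, so monotonicity of the integral suffices.\<close>

lemma expectation_max_add_ge:
  fixes f g :: "'a \<Rightarrow> real"
  assumes "integrable M f" "integrable M g"
  shows "max 0 (expectation f + expectation g - 1) \<le> expectation (\<lambda>\<omega>. max 0 (f \<omega> + g \<omega> - 1))"
proof (rule max.boundedI)
  have "expectation (\<lambda>\<omega>. f \<omega> + g \<omega> - 1) \<le> expectation (\<lambda>\<omega>. max 0 (f \<omega> + g \<omega> - 1))"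
    using assms by (intro integral_mono integrable_max) auto
  then show "expectation f + expectation g - 1 \<le> expectation (\<lambda>\<omega>. max 0 (f \<omega> + g \<omega> - 1))"
    using assms by (simp add: prob_space)
qed simp

text \<open>The concave counterpart: the minimum lies below each of its arguments.\<close>

lemma expectation_min_le:
  fixes f g :: "'a \<Rightarrow> real"
  assumes "integrable M f" "integrable M g"
  shows "expectation (\<lambda>\<omega>. min (f \<omega>) (g \<omega>)) \<le> min (expectation f) (expectation g)"
  using assms by (intro min.boundedI integral_mono integrable_min) auto

lemma cond_frechet_bounds:
  assumes X [measurable]: "X \<in> M \<rightarrow>\<^sub>M N" and A: "A \<in> events" and B: "B \<in> events"
    and a: "is_cond_prob M N X A a" and b: "is_cond_prob M N X B b"
  shows "(LINT x|distr M N X. max 0 (a x + b x - 1)) \<le> prob (A \<inter> B)"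
    and "prob (A \<inter> B) \<le> (LINT x|distr M N X. min (a x) (b x))"
    and "max 0 (prob A + prob B - 1) \<le> (LINT x|distr M N X. max 0 (a x + b x - 1))"
    and "(LINT x|distr M N X. min (a x) (b x)) \<le> min (prob A) (prob B)"
proof -
  have [measurable]: "a \<in> borel_measurable N" "b \<in> borel_measurable N"
    using a b by (simp_all add: is_cond_prob_def)
  \<comment> \<open>Change of variables from the distribution of \<open>X\<close> to the underlying
    space, where the preceding lemmas live.\<close>
  have dist:
    "(LINT x|distr M N X. max 0 (a x + b x - 1)) = expectation (\<lambda>\<omega>. max 0 (a (X \<omega>) + b (X \<omega>) - 1))"
    "(LINT x|distr M N X. min (a x) (b x)) = expectation (\<lambda>\<omega>. min (a (X \<omega>)) (b (X \<omega>)))"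
    by (rule integral_distr; measurable)+
  note ints = is_cond_prob_integrable[OF X A a] is_cond_prob_integrable[OF X B b]
  note exps = is_cond_prob_expectation[OF X A a] is_cond_prob_expectation[OF X B b]
  show "(LINT x|distr M N X. max 0 (a x + b x - 1)) \<le> prob (A \<inter> B)"
    unfolding dist by (rule cond_frechet_lower[OF assms])
  show "prob (A \<inter> B) \<le> (LINT x|distr M N X. min (a x) (b x))"
    unfolding dist by (rule cond_frechet_upper[OF assms])
  show "max 0 (prob A + prob B - 1) \<le> (LINT x|distr M N X. max 0 (a x + b x - 1))"
    using expectation_max_add_ge[OF ints] unfolding dist exps .
  show "(LINT x|distr M N X. min (a x) (b x)) \<le> min (prob A) (prob B)"
    using expectation_min_le[OF ints] unfolding dist exps .
qed

end

theorem mainTheorem1: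
  fixes M :: "'a measure" and N :: "'b measure"
    and Y0 Y1 :: "'a \<Rightarrow> nat" and X :: "'a \<Rightarrow> 'b"
    and S0 S1 :: "'b \<Rightarrow> real"
    and p0 p1 \<alpha> \<beta> \<gamma> \<delta> :: real
  assumes "prob_space M"
    and "Y0 \<in> M \<rightarrow>\<^sub>M count_space {0, 1}"
    and "Y1 \<in> M \<rightarrow>\<^sub>M count_space {0, 1}"
    and "X \<in> M \<rightarrow>\<^sub>M N"
    and "is_cond_prob M N X {\<omega> \<in> space M. Y0 \<omega> = 1} S0"
    and "is_cond_prob M N X {\<omega> \<in> space M. Y1 \<omega> = 1} S1"
    and "p0 = \<P>(\<omega> in M. Y0 \<omega> = 1)"
    and "p1 = \<P>(\<omega> in M. Y1 \<omega> = 1)"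
    and "\<alpha> = \<P>(\<omega> in M. Y0 \<omega> = 0 \<and> Y1 \<omega> = 0)"
    and "\<beta> = \<P>(\<omega> in M. Y0 \<omega> = 1 \<and> Y1 \<omega> = 0)"
    and "\<gamma> = \<P>(\<omega> in M. Y0 \<omega> = 0 \<and> Y1 \<omega> = 1)"
    and "\<delta> = \<P>(\<omega> in M. Y0 \<omega> = 1 \<and> Y1 \<omega> = 1)"
  shows "let E = (\<lambda>g. LINT x|distr M N X. g x) in
      p0 = E (\<lambda>x. S0 x) \<and> p1 = E (\<lambda>x. S1 x) \<and>

      E (\<lambda>x. max 0 (1 - S0 x - S1 x)) \<le> \<alpha> \<and> \<alpha> \<le> E (\<lambda>x. min (1 - S0 x) (1 - S1 x)) \<and>
      E (\<lambda>x. max 0 (S0 x - S1 x)) \<le> \<beta> \<and> \<beta> \<le> E (\<lambda>x. min (S0 x) (1 - S1 x)) \<and>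
      E (\<lambda>x. max 0 (S1 x - S0 x)) \<le> \<gamma> \<and> \<gamma> \<le> E (\<lambda>x. min (1 - S0 x) (S1 x)) \<and>
      E (\<lambda>x. max 0 (S0 x + S1 x - 1)) \<le> \<delta> \<and> \<delta> \<le> E (\<lambda>x. min (S0 x) (S1 x)) \<and>

      max 0 (1 - p0 - p1) \<le> E (\<lambda>x. max 0 (1 - S0 x - S1 x)) \<and>
      max 0 (p0 - p1) \<le> E (\<lambda>x. max 0 (S0 x - S1 x)) \<and>
      max 0 (p1 - p0) \<le> E (\<lambda>x. max 0 (S1 x - S0 x)) \<and>
      max 0 (p0 + p1 - 1) \<le> E (\<lambda>x. max 0 (S0 x + S1 x - 1)) \<and>

      E (\<lambda>x. min (1 - S0 x) (1 - S1 x)) \<le> min (1 - p0) (1 - p1) \<and>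
      E (\<lambda>x. min (S0 x) (1 - S1 x)) \<le> min p0 (1 - p1) \<and>
      E (\<lambda>x. min (1 - S0 x) (S1 x)) \<le> min (1 - p0) p1 \<and>
      E (\<lambda>x. min (S0 x) (S1 x)) \<le> min p0 p1"
proof -
  interpret prob_space M by fact
  note X = assms(4) and s0 = assms(5) and s1 = assms(6)
  define A where "A = {\<omega> \<in> space M. Y0 \<omega> = 1}"
  define B where "B = {\<omega> \<in> space M. Y1 \<omega> = 1}"
  \<comment> \<open>Since the outcomes are binary, the event of value 0 is exactly the complement of
    the event of value 1; the identification of the cells rests on this.\<close>
  have Y: "Y0 \<omega> \<in> {0, 1}" "Y1 \<omega> \<in> {0, 1}" if "\<omega> \<in> space M" for \<omega>
    using measurable_space[OF assms(2) that] measurable_space[OF assms(3) that] by auto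
  have "Y0 -` {1} \<inter> space M \<in> events" "Y1 -` {1} \<inter> space M \<in> events"
    by (rule measurable_sets[OF assms(2)], simp) (rule measurable_sets[OF assms(3)], simp)
  moreover have "A = Y0 -` {1} \<inter> space M" "B = Y1 -` {1} \<inter> space M"
    by (auto simp: A_def B_def)
  ultimately have A: "A \<in> events" and B: "B \<in> events" by simp_all
  let ?A' = "space M - A" and ?B' = "space M - B"
  have A': "?A' \<in> events" and B': "?B' \<in> events" using A B by auto
  have a: "is_cond_prob M N X A S0" and b: "is_cond_prob M N X B S1"
    using s0 s1 by (simp_all add: A_def B_def)
  note a' = is_cond_prob_compl[OF X A a] and b' = is_cond_prob_compl[OF X B b]
  have p: "p0 = prob A" "p1 = prob B" by (simp_all add: assms(7,8) A_def B_def)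
  have p': "prob ?A' = 1 - p0" "prob ?B' = 1 - p1" using A B by (simp_all add: p prob_compl)
  have cells: "\<alpha> = prob (?A' \<inter> ?B')" "\<beta> = prob (A \<inter> ?B')" "\<gamma> = prob (?A' \<inter> B)" "\<delta> = prob (A \<inter> B)"
    unfolding assms(9-12) A_def B_def using Y by (auto intro!: arg_cong[where f=prob])
  have "S0 \<in> borel_measurable N" "S1 \<in> borel_measurable N"
    using s0 s1 by (simp_all add: is_cond_prob_def)
  then have means: "p0 = (LINT x|distr M N X. S0 x)" "p1 = (LINT x|distr M N X. S1 x)"
    using is_cond_prob_expectation[OF X A a] is_cond_prob_expectation[OF X B b]
    by (simp_all add: p integral_distr[OF X])
  \<comment> \<open>Inserting complements into the term \<open>a + b - 1\<close> leaves these three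
    shapes, both in the integrands and in the constants; they are brought to the form in which the
    bounds are stated.\<close>
  have arith: "1 - x + (1 - y) - 1 = 1 - x - y" "x + (1 - y) - 1 = x - y" "1 - x + y - 1 = y - x"
    for x y :: real by simp_all
  note \<alpha> = cond_frechet_bounds[OF X A' B' a' b', folded cells, unfolded p' arith]
    and \<beta> = cond_frechet_bounds[OF X A B' a b', folded cells p, unfolded p' arith]
    and \<gamma> = cond_frechet_bounds[OF X A' B a' b, folded cells p, unfolded p' arith]
    and \<delta> = cond_frechet_bounds[OF X A B a b, folded cells p]
  show ?thesis
    unfolding Let_def by (intro conjI means \<alpha> \<beta> \<gamma> \<delta>)
qed

end
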